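(* Let $h>0$ be sufficiently small (in the sense made precise in the context), let $L:Q^2\times\mathbb{R}^2\to\mathbb{R}$ be a discrete Lagrangian with fixed step size $h$, and let $x=(x_0,\ldots,x_N)\in Q^{N+1}$ be a discrete curve with $z=(z_0,\ldots,z_N)$ defined by $z_0=0$ and $$z_{j+1}-z_j=h\,L(x_j,x_{j+1},z_j,z_{j+1}),\qquad j=0,\ldots,N-1.$$ Then $x$ is a solution of the discrete Herglotz variational principle if and only if it satisfies, for all $j\in\{1,\ldots,N-1\}$, the discrete generalized Euler-Lagrange equations $$\mathrm{D}_1L(x_j,x_{j+1},z_j,z_{j+1})+\mathrm{D}_2L(x_{j-1},x_j,z_{j-1},z_j)\,\frac{1+h\,\mathrm{D}_3L(x_j,x_{j+1},z_j,z_{j+1})}{1-h\,\mathrm{D}_4L(x_{j-1},x_j,z_{j-1},z_j)}=0.$$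
   Context: $Q$ is the configuration space, an $n$-dimensional smooth manifold described in local coordinates. A discrete Lagrangian is a smooth function $L:Q^2\times\mathbb{R}^2\times\mathbb{R}\to\mathbb{R}$, $(x_j,x_{j+1},z_j,z_{j+1};h)\mapsto L(x_j,x_{j+1},z_j,z_{j+1};h)$, where $h>0$ is the step size; $h$ is fixed and omitted from the notation. $\mathrm{D}_iL$ denotes the partial derivative of $L$ with respect to its $i$-th entry; $\mathrm{D}_1L,\mathrm{D}_2L$ are vectors with $n$ components and $\mathrm{D}_3L,\mathrm{D}_4L$ are scalars. Given a discrete curve $x=(x_0,\ldots,x_N)\in Q^{N+1}$, define $z=(z_0,\ldots,z_N)\in\mathbb{R}^{N+1}$ by $z_0=0$ and $z_{j+1}-z_j=hL(x_j,x_{j+1},z_j,z_{j+1})$. In this way $z_j$ is a function of $x_0,\ldots,x_j$. The discrete curve $x$ is a solution to the discrete Herglotz variational principle if $$\frac{\partial z_{j+1}}{\partial x_j}=0\quad\text{for all } j\in\{1,\ldots,N-1\},$$ where $\partial z_{j+1}/\partial x_j$ is the partial derivative of $z_{j+1}$, as a function of $x_0,\ldots,x_{j+1}$, with respect to $x_j$. "$h$ sufficiently small" means: $h$ is small enough that the relation $z_{j+1}-z_j=hL(x_j,x_{j+1},z_j,z_{j+1})$ determines $z_{j+1}$ as a smooth function of $(x_j,x_{j+1},z_j)$ near the curve under consideration and that $1-h\,\mathrm{D}_4L(x_j,x_{j+1},z_j,z_{j+1})\neq0$ along the curve for all $j\in\{0,\ldots,N-1\}$. *)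

theory Defs
  imports "HOL-Analysis.Analysis"
begin

text \<open>
  Smoothness on an open set of a finite-dimensional space. In finite dimension, \<open>f\<close> is
  \<open>C\<^sup>k\<^sup>+\<^sup>1\<close> iff it is differentiable and all its directional derivatives are \<open>C\<^sup>k\<close>.
\<close>

primrec Ck_on :: "nat \<Rightarrow> 'a::real_normed_vector set \<Rightarrow> ('a \<Rightarrow> 'b::real_normed_vector) \<Rightarrow> bool" where
  "Ck_on 0 S f \<longleftrightarrow> continuous_on S f"
| "Ck_on (Suc k) S f \<longleftrightarrow>
     (\<forall>x\<in>S. f differentiable (at x)) \<and>
     (\<forall>v. Ck_on k S (\<lambda>x. frechet_derivative f (at x) v))"

definition smooth_on :: "'a::real_normed_vector set \<Rightarrow> ('a \<Rightarrow> 'b::real_normed_vector) \<Rightarrow> bool" where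
  "smooth_on S f \<longleftrightarrow> (\<forall>k. Ck_on k S f)"

text \<open>A chart is a domain together with a coordinate map; the values of the map outside
  the domain are irrelevant.\<close>

type_synonym ('q, 'n) chart = "'q set \<times> ('q \<Rightarrow> real^'n)"

definition chart_inv :: "('q, 'n::finite) chart \<Rightarrow> real^'n \<Rightarrow> 'q" where
  "chart_inv c = inv_into (fst c) (snd c)"

definition smooth_manifold :: "'q topology \<Rightarrow> ('q, 'n::finite) chart set \<Rightarrow> bool" where
  "smooth_manifold Q \<A> \<longleftrightarrow>
     Hausdorff_space Q \<and> second_countable Q \<and>
     topspace Q = (\<Union>c\<in>\<A>. fst c) \<and>
     (\<forall>c\<in>\<A>. openin Q (fst c) \<and> open (snd c ` fst c) \<and>
        homeomorphic_map (subtopology Q (fst c)) (top_of_set (snd c ` fst c)) (snd c)) \<and>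
     (\<forall>c\<in>\<A>. \<forall>d\<in>\<A>. smooth_on (snd c ` (fst c \<inter> fst d)) (snd d \<circ> chart_inv c))"

text \<open>Smoothness of a real function on the open subset \<open>U \<times> V \<times> S\<close> of the
  manifold \<open>Q \<times> Q \<times> 's\<close>, where \<open>'s\<close> is \<open>\<real>\<close> or \<open>\<real> \<times> \<real>\<close> below.\<close>

definition smooth_QQ_on ::
  "('q, 'n::finite) chart set \<Rightarrow> 'q set \<Rightarrow> 'q set \<Rightarrow> 's::euclidean_space set \<Rightarrow>
     ('q \<Rightarrow> 'q \<Rightarrow> 's \<Rightarrow> real) \<Rightarrow> bool" where
  "smooth_QQ_on \<A> U V S F \<longleftrightarrow>
     (\<forall>c\<in>\<A>. \<forall>d\<in>\<A>.
        smooth_on ((snd c ` (fst c \<inter> U)) \<times> (snd d ` (fst d \<inter> V)) \<times> S)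
          (\<lambda>(u, v, s). F (chart_inv c u) (chart_inv d v) s))"

definition discrete_Lagrangian ::
  "'q topology \<Rightarrow> ('q, 'n::finite) chart set \<Rightarrow> ('q \<Rightarrow> 'q \<Rightarrow> real \<Rightarrow> real \<Rightarrow> real) \<Rightarrow> bool" where
  "discrete_Lagrangian Q \<A> L \<longleftrightarrow>
     smooth_QQ_on \<A> (topspace Q) (topspace Q) UNIV (\<lambda>p q (s, r). L p q s r)"

text \<open>The vector of partial derivatives of \<open>f\<close> at \<open>p\<close> in the coordinates given by \<open>c\<close>.\<close>

definition chart_partials :: "('q, 'n::finite) chart \<Rightarrow> ('q \<Rightarrow> real) \<Rightarrow> 'q \<Rightarrow> real^'n" where
  "chart_partials c f p =
     (\<chi> i. deriv (\<lambda>t. f (chart_inv c (snd c p + t *\<^sub>R axis i 1))) 0)"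

definition D1 ::
  "('q, 'n::finite) chart \<Rightarrow> ('q \<Rightarrow> 'q \<Rightarrow> real \<Rightarrow> real \<Rightarrow> real) \<Rightarrow>
     'q \<Rightarrow> 'q \<Rightarrow> real \<Rightarrow> real \<Rightarrow> real^'n" where
  "D1 c L p q s r = chart_partials c (\<lambda>p'. L p' q s r) p"

definition D2 ::
  "('q, 'n::finite) chart \<Rightarrow> ('q \<Rightarrow> 'q \<Rightarrow> real \<Rightarrow> real \<Rightarrow> real) \<Rightarrow>
     'q \<Rightarrow> 'q \<Rightarrow> real \<Rightarrow> real \<Rightarrow> real^'n" where
  "D2 c L p q s r = chart_partials c (\<lambda>q'. L p q' s r) q"

definition D3 ::
  "('q \<Rightarrow> 'q \<Rightarrow> real \<Rightarrow> real \<Rightarrow> real) \<Rightarrow> 'q \<Rightarrow> 'q \<Rightarrow> real \<Rightarrow> real \<Rightarrow> real" where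
  "D3 L p q s r = deriv (\<lambda>s'. L p q s' r) s"

definition D4 ::
  "('q \<Rightarrow> 'q \<Rightarrow> real \<Rightarrow> real \<Rightarrow> real) \<Rightarrow> 'q \<Rightarrow> 'q \<Rightarrow> real \<Rightarrow> real \<Rightarrow> real" where
  "D4 L p q s r = deriv (\<lambda>r'. L p q s r') r"

text \<open>
  Near the point \<open>(p, q, s, r)\<close>, the relation \<open>r' - s' = h L(p', q', s', r')\<close> determines
  \<open>r'\<close> as the smooth function \<open>\<zeta>\<close> of \<open>(p', q', s')\<close>. The condition only constrains the
  germ of \<open>\<zeta>\<close> at \<open>(p, q, s)\<close>.
\<close>

definition determines_near ::
  "'q topology \<Rightarrow> ('q, 'n::finite) chart set \<Rightarrow> ('q \<Rightarrow> 'q \<Rightarrow> real \<Rightarrow> real \<Rightarrow> real) \<Rightarrow> real \<Rightarrow>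
     'q \<Rightarrow> 'q \<Rightarrow> real \<Rightarrow> real \<Rightarrow> ('q \<Rightarrow> 'q \<Rightarrow> real \<Rightarrow> real) \<Rightarrow> bool" where
  "determines_near Q \<A> L h p q s r \<zeta> \<longleftrightarrow>
     (\<exists>U V S R. openin Q U \<and> openin Q V \<and> open S \<and> open R \<and>
        p \<in> U \<and> q \<in> V \<and> s \<in> S \<and> r \<in> R \<and>
        smooth_QQ_on \<A> U V S \<zeta> \<and>
        (\<forall>p'\<in>U. \<forall>q'\<in>V. \<forall>s'\<in>S. \<zeta> p' q' s' \<in> R \<and>
           (\<forall>r'\<in>R. r' - s' = h * L p' q' s' r' \<longleftrightarrow> r' = \<zeta> p' q' s')))"

text \<open>\<open>z\<^sub>j\<close> as a function of the discrete curve \<open>y\<close>; it depends on \<open>y\<^sub>0, \<dots>, y\<^sub>j\<close> only.\<close>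

primrec z_of ::
  "(nat \<Rightarrow> 'q \<Rightarrow> 'q \<Rightarrow> real \<Rightarrow> real) \<Rightarrow> (nat \<Rightarrow> 'q) \<Rightarrow> nat \<Rightarrow> real" where
  "z_of \<zeta> y 0 = 0"
| "z_of \<zeta> y (Suc j) = \<zeta> j (y j) (y (Suc j)) (z_of \<zeta> y j)"

text \<open>\<open>\<partial>z\<^sub>j\<^sub>+\<^sub>1/\<partial>x\<^sub>j = 0\<close> for all interior \<open>j\<close>, in the coordinates \<open>c j\<close> around \<open>x j\<close>.\<close>

definition discrete_Herglotz_solution ::
  "(nat \<Rightarrow> ('q, 'n::finite) chart) \<Rightarrow> (nat \<Rightarrow> 'q \<Rightarrow> 'q \<Rightarrow> real \<Rightarrow> real) \<Rightarrow>
     nat \<Rightarrow> (nat \<Rightarrow> 'q) \<Rightarrow> bool" where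
  "discrete_Herglotz_solution c \<zeta> N x \<longleftrightarrow>
     (\<forall>j\<in>{1..<N}. chart_partials (c j) (\<lambda>p. z_of \<zeta> (x(j := p)) (j + 1)) (x j) = 0)"

end

theory Submission
  imports Defs
begin

text \<open>
  Varying \<open>x\<^sub>j\<close> along a coordinate line leaves \<open>z\<^sub>0, \<dots>, z\<^sub>j\<^sub>-\<^sub>1\<close> fixed. Differentiating the
  relations defining \<open>z\<^sub>j\<close> and \<open>z\<^sub>j\<^sub>+\<^sub>1\<close> implicitly gives
  \<open>(1 - h D\<^sub>4L\<^sub>j\<^sub>-\<^sub>1) \<partial>z\<^sub>j = h D\<^sub>2L\<^sub>j\<^sub>-\<^sub>1\<close> and
  \<open>(1 - h D\<^sub>4L\<^sub>j) \<partial>z\<^sub>j\<^sub>+\<^sub>1 = h D\<^sub>1L\<^sub>j + (1 + h D\<^sub>3L\<^sub>j) \<partial>z\<^sub>j\<close>.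
  Eliminating \<open>\<partial>z\<^sub>j\<close> exhibits \<open>\<partial>z\<^sub>j\<^sub>+\<^sub>1\<close> as a nonzero multiple of the left-hand side of the
  Euler-Lagrange equation.
\<close>

section \<open>Derivatives along curves and differentiability from smoothness\<close>

lemma has_real_derivative_along_curve:
  fixes F :: "'a::real_normed_vector \<Rightarrow> real"
  assumes "(F has_derivative A) (at (\<gamma> t))" and "(\<gamma> has_vector_derivative w) (at t)"
  shows "((\<lambda>s. F (\<gamma> s)) has_real_derivative A w) (at t)"
proof -
  \<comment> \<open>The chain rule applied below asks for the derivative of \<open>F\<close> within
    the image of the curve.\<close>
  have "(F has_derivative A) (at (\<gamma> t) within range \<gamma>)"
    using assms(1) by (rule has_derivative_at_withinI)
  then have "(F \<circ> \<gamma> has_vector_derivative A w) (at t)"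
    using vector_derivative_diff_chain_within[OF assms(2)] by blast
  then show ?thesis
    by (simp add: o_def has_real_derivative_iff_has_vector_derivative)
qed

lemma smooth_on_differentiable:
  assumes "smooth_on S f" and "x \<in> S"
  shows "f differentiable (at x)"
proof -
  have "Ck_on (Suc 0) S f" using assms(1) unfolding smooth_on_def by blast
  then show ?thesis using assms(2) by simp
qed

section \<open>Charts and coordinate lines\<close>

text \<open>The curve underlying \<open>chart_partials\<close>. Only small \<open>t\<close> are
  meaningful: once the argument leaves the chart image, \<open>chart_inv\<close> is an unspecified
  value.\<close>

definition coordinate_line :: "('q, 'n::finite) chart \<Rightarrow> 'n \<Rightarrow> 'q \<Rightarrow> real \<Rightarrow> 'q" where
  "coordinate_line c i p t = chart_inv c (snd c p + t *\<^sub>R axis i 1)"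

lemma chart_partials_nth:
  "chart_partials c f p $ i = deriv (\<lambda>t. f (coordinate_line c i p t)) 0"
  by (simp add: chart_partials_def coordinate_line_def)

lemma chart_inj_on:
  assumes "smooth_manifold Q \<A>" and "c \<in> \<A>"
  shows "inj_on (snd c) (fst c)"
proof -
  have "homeomorphic_map (subtopology Q (fst c)) (top_of_set (snd c ` fst c)) (snd c)"
    and "openin Q (fst c)"
    using assms unfolding smooth_manifold_def by blast+
  then show ?thesis
    by (metis homeomorphic_imp_injective_map topspace_subtopology_subset openin_subset)
qed

lemma chart_inv_chart [simp]:
  assumes "smooth_manifold Q \<A>" and "c \<in> \<A>" and "p \<in> fst c"
  shows "chart_inv c (snd c p) = p"
  unfolding chart_inv_def using chart_inj_on[OF assms(1,2)] assms(3) by (rule inv_into_f_f)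

lemma coordinate_line_0:
  assumes "smooth_manifold Q \<A>" and "c \<in> \<A>" and "p \<in> fst c"
  shows "coordinate_line c i p 0 = p"
  using chart_inv_chart[OF assms] by (simp add: coordinate_line_def)

text \<open>A chart is a homeomorphism onto its image, and that image is open, so relatively open
  subsets of it are open.\<close>

lemma open_chart_image:
  assumes "smooth_manifold Q \<A>" and "c \<in> \<A>" and "openin Q U"
  shows "open (snd c ` (fst c \<inter> U))"
proof -
  have hom: "homeomorphic_map (subtopology Q (fst c)) (top_of_set (snd c ` fst c)) (snd c)"
    and op: "open (snd c ` fst c)"
    using assms unfolding smooth_manifold_def by blast+
  have "openin (subtopology Q (fst c)) (fst c \<inter> U)"
    using assms(3) by (rule openin_subtopology_Int2)
  then have "openin (top_of_set (snd c ` fst c)) (snd c ` (fst c \<inter> U))"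
    using hom by (meson homeomorphic_imp_open_map open_map_def)
  then show ?thesis using op openin_open_eq by blast
qed

text \<open>The affine line in coordinates pulls the open image of \<open>U\<close> back to an open
  set containing 0. The filter is \<open>nhds 0\<close>, so that 0 itself is included, as needed for
  replacing a function by another under a derivative.\<close>

lemma eventually_coordinate_line_in:
  assumes "smooth_manifold Q \<A>" and "c \<in> \<A>" and "openin Q U" and "p \<in> fst c" and "p \<in> U"
  shows "\<forall>\<^sub>F t in nhds 0. coordinate_line c i p t \<in> U"
proof -
  let ?\<gamma> = "\<lambda>t. snd c p + t *\<^sub>R axis i (1::real)"
  have "open (?\<gamma> -` (snd c ` (fst c \<inter> U)))"
    using open_chart_image[OF assms(1-3)] by (rule open_vimage) (intro continuous_intros)
  moreover have "0 \<in> ?\<gamma> -` (snd c ` (fst c \<inter> U))"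
    using assms(4,5) by auto
  ultimately have "\<forall>\<^sub>F t in nhds 0. t \<in> ?\<gamma> -` (snd c ` (fst c \<inter> U))"
    by (rule eventually_nhds_in_open)
  then show ?thesis
  proof eventually_elim
    case (elim t)
    then obtain q where "?\<gamma> t = snd c q" "q \<in> fst c" "q \<in> U" by auto
    then show ?case using chart_inv_chart[OF assms(1,2)] by (simp add: coordinate_line_def)
  qed
qed

section \<open>Smooth functions restricted to coordinate lines\<close>

lemma smooth_QQ_on_has_derivative:
  assumes "smooth_QQ_on \<A> U V S F" and "c \<in> \<A>" and "d \<in> \<A>"
    and "p \<in> fst c \<inter> U" and "q \<in> fst d \<inter> V" and "s \<in> S"
  obtains A where
    "((\<lambda>(u, v, s). F (chart_inv c u) (chart_inv d v) s) has_derivative A)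
       (at (snd c p, snd d q, s))"
proof -
  have "smooth_on ((snd c ` (fst c \<inter> U)) \<times> (snd d ` (fst d \<inter> V)) \<times> S)
          (\<lambda>(u, v, s). F (chart_inv c u) (chart_inv d v) s)"
    using assms(1-3) unfolding smooth_QQ_on_def by blast
  then have "(\<lambda>(u, v, s). F (chart_inv c u) (chart_inv d v) s) differentiable
               (at (snd c p, snd d q, s))"
    using assms(4-6) by (intro smooth_on_differentiable) auto
  then show thesis using that unfolding differentiable_def by blast
qed

text \<open>The real argument moves along with the first point, because z at index j itself varies
  with the point at index j. Existence suffices here; the implicit relation later yields the
  value.\<close>

lemma smooth_QQ_on_fst_line_differentiable:
  assumes "smooth_manifold Q \<A>" and "smooth_QQ_on \<A> U V S F"
    and "c \<in> \<A>" and "d \<in> \<A>" and "p \<in> fst c \<inter> U" and "q \<in> fst d \<inter> V" and "g 0 \<in> S"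
    and "(g has_vector_derivative g') (at 0)"
  shows "\<exists>G'. ((\<lambda>t. F (coordinate_line c i p t) q (g t)) has_real_derivative G') (at 0)"
proof -
  obtain A where A: "((\<lambda>(u, v, s). F (chart_inv c u) (chart_inv d v) s) has_derivative A)
       (at (snd c p, snd d q, g 0))"
    using smooth_QQ_on_has_derivative[OF assms(2-7)] .
  let ?F = "\<lambda>(u, v, s). F (chart_inv c u) (chart_inv d v) s"
  let ?\<gamma> = "\<lambda>t. (snd c p + t *\<^sub>R axis i 1, snd d q, g t)"
  have "(?\<gamma> has_vector_derivative (axis i 1, 0, g')) (at 0)"
    by (auto intro!: derivative_eq_intros has_vector_derivative_Pair assms(8))
  from has_real_derivative_along_curve[OF _ this, of ?F A] A
  have "((\<lambda>t. case ?\<gamma> t of (u, v, s) \<Rightarrow> F (chart_inv c u) (chart_inv d v) s)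
      has_real_derivative A (axis i 1, 0, g')) (at 0)"
    by simp
  then show ?thesis
    using chart_inv_chart[OF assms(1,4)] assms(6) by (auto simp: coordinate_line_def)
qed

lemma smooth_QQ_on_snd_line_differentiable:
  assumes "smooth_manifold Q \<A>" and "smooth_QQ_on \<A> U V S F"
    and "c \<in> \<A>" and "d \<in> \<A>" and "p \<in> fst c \<inter> U" and "q \<in> fst d \<inter> V" and "s \<in> S"
  shows "\<exists>G'. ((\<lambda>t. F p (coordinate_line d i q t) s) has_real_derivative G') (at 0)"
proof -
  obtain A where A: "((\<lambda>(u, v, s). F (chart_inv c u) (chart_inv d v) s) has_derivative A)
       (at (snd c p, snd d q, s))"
    using smooth_QQ_on_has_derivative[OF assms(2-7)] .
  let ?F = "\<lambda>(u, v, s). F (chart_inv c u) (chart_inv d v) s"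
  let ?\<gamma> = "\<lambda>t. (snd c p, snd d q + t *\<^sub>R axis i 1, s)"
  have "(?\<gamma> has_vector_derivative (0, axis i 1, 0)) (at 0)"
    by (auto intro!: derivative_eq_intros has_vector_derivative_Pair)
  from has_real_derivative_along_curve[OF _ this, of ?F A] A
  have "((\<lambda>t. case ?\<gamma> t of (u, v, s) \<Rightarrow> F (chart_inv c u) (chart_inv d v) s)
      has_real_derivative A (0, axis i 1, 0)) (at 0)"
    by simp
  then show ?thesis
    using chart_inv_chart[OF assms(1,3)] assms(5) by (auto simp: coordinate_line_def)
qed

section \<open>Chain rule for the discrete Lagrangian\<close>

context
  fixes Q :: "'q topology" and \<A> :: "('q, 'n::finite) chart set"
    and L :: "'q \<Rightarrow> 'q \<Rightarrow> real \<Rightarrow> real \<Rightarrow> real"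
    and c d :: "('q, 'n) chart" and p q :: 'q
    and g G :: "real \<Rightarrow> real" and g' G' :: real
  assumes mf: "smooth_manifold Q \<A>" and dL: "discrete_Lagrangian Q \<A> L"
    and c: "c \<in> \<A>" "p \<in> fst c" and d: "d \<in> \<A>" "q \<in> fst d"
    and g: "(g has_real_derivative g') (at 0)" and G: "(G has_real_derivative G') (at 0)"
begin

text \<open>In charts \<open>L\<close> has one Frechet derivative \<open>A\<close>. The partial
  derivatives are values of \<open>A\<close> on basis directions, and linearity of \<open>A\<close>
  assembles them into both formulas.\<close>

lemma discrete_Lagrangian_chain_rule:
  shows discrete_Lagrangian_fst_line_derivative:
    "((\<lambda>t. L (coordinate_line c i p t) q (g t) (G t)) has_real_derivative
       D1 c L p q (g 0) (G 0) $ i + D3 L p q (g 0) (G 0) * g' + D4 L p q (g 0) (G 0) * G') (at 0)"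
  and discrete_Lagrangian_snd_line_derivative:
    "((\<lambda>t. L p (coordinate_line d i q t) (g t) (G t)) has_real_derivative
       D2 d L p q (g 0) (G 0) $ i + D3 L p q (g 0) (G 0) * g' + D4 L p q (g 0) (G 0) * G') (at 0)"
proof -
  let ?L = "\<lambda>(u, v, s, r). L (chart_inv c u) (chart_inv d v) s r"
  have "p \<in> topspace Q" "q \<in> topspace Q"
    using mf c d unfolding smooth_manifold_def by blast+
  then obtain A where A: "(?L has_derivative A) (at (snd c p, snd d q, g 0, G 0))"
    using smooth_QQ_on_has_derivative[of \<A> "topspace Q" "topspace Q" UNIV
        "\<lambda>p q (s, r). L p q s r" c d p q "(g 0, G 0)"] dL c d
    unfolding discrete_Lagrangian_def by (auto simp: case_prod_unfold)
  have p [simp]: "chart_inv c (snd c p) = p" and q [simp]: "chart_inv d (snd d q) = q"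
    using chart_inv_chart[OF mf] c d by auto
  \<comment> \<open>The base time \<open>t0\<close> is arbitrary because \<open>D3\<close> and
    \<open>D4\<close> differentiate at \<open>g 0\<close> and \<open>G 0\<close>, along the identity
    curve, rather than at 0.\<close>
  have curve: "((\<lambda>t. L (chart_inv c (u t)) (chart_inv d (v t)) (s t) (r t))
      has_real_derivative A (u', v', s', r')) (at t0)"
    if "(u has_vector_derivative u') (at t0)" "(v has_vector_derivative v') (at t0)"
      "(s has_vector_derivative s') (at t0)" "(r has_vector_derivative r') (at t0)"
      "u t0 = snd c p" "v t0 = snd d q" "s t0 = g 0" "r t0 = G 0"
    for u v s r u' v' s' r' t0
  proof -
    have "((\<lambda>t. (u t, v t, s t, r t)) has_vector_derivative (u', v', s', r')) (at t0)"
      using that by (intro has_vector_derivative_Pair)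
    from has_real_derivative_along_curve[OF _ this, of ?L A] A that show ?thesis by simp
  qed
  have line: "((\<lambda>t. a + t *\<^sub>R b) has_vector_derivative b) (at 0)" for a b :: "real^'n"
    by (auto intro!: derivative_eq_intros)
  have g: "(g has_vector_derivative g') (at 0)" and G: "(G has_vector_derivative G') (at 0)"
    using g G by (simp_all add: has_real_derivative_iff_has_vector_derivative)
  have D1: "D1 c L p q (g 0) (G 0) $ i = A (axis i 1, 0, 0, 0)"
    unfolding D1_def chart_partials_nth
    using curve[OF line[of "snd c p" "axis i 1"], of "\<lambda>_. snd d q" 0 "\<lambda>_. g 0" 0 "\<lambda>_. G 0" 0]
    by (intro DERIV_imp_deriv) (simp add: coordinate_line_def)
  have D2: "D2 d L p q (g 0) (G 0) $ i = A (0, axis i 1, 0, 0)"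
    unfolding D2_def chart_partials_nth
    using curve[OF _ line[of "snd d q" "axis i 1"], of "\<lambda>_. snd c p" 0 "\<lambda>_. g 0" 0 "\<lambda>_. G 0" 0]
    by (intro DERIV_imp_deriv) (simp add: coordinate_line_def)
  have D3: "D3 L p q (g 0) (G 0) = A (0, 0, 1, 0)"
    unfolding D3_def
    using curve[of "\<lambda>_. snd c p" 0 "g 0" "\<lambda>_. snd d q" 0 "\<lambda>t. t" 1 "\<lambda>_. G 0" 0]
    by (intro DERIV_imp_deriv) simp
  have D4: "D4 L p q (g 0) (G 0) = A (0, 0, 0, 1)"
    unfolding D4_def
    using curve[of "\<lambda>_. snd c p" 0 "G 0" "\<lambda>_. snd d q" 0 "\<lambda>_. g 0" 0 "\<lambda>t. t" 1]
    by (intro DERIV_imp_deriv) simp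
  have lin: "linear A" using A by (rule has_derivative_linear)
  \<comment> \<open>The chart directions \<open>a\<close> and \<open>b\<close> stay free so that one
    splitting serves both the first-slot and the second-slot formula.\<close>
  have A_eq: "A (a, b, g', G') = A (a, b, 0, 0) + A (0, 0, 1, 0) * g' + A (0, 0, 0, 1) * G'"
    for a b
  proof -
    have "(a, b, g', G') = (a, b, 0, 0) + g' *\<^sub>R (0, 0, 1, 0) + G' *\<^sub>R (0, 0, 0, 1)" by simp
    then show ?thesis by (simp only: linear_add[OF lin] linear_scale[OF lin]) simp
  qed
  show "((\<lambda>t. L (coordinate_line c i p t) q (g t) (G t)) has_real_derivative
       D1 c L p q (g 0) (G 0) $ i + D3 L p q (g 0) (G 0) * g' + D4 L p q (g 0) (G 0) * G') (at 0)"
    using curve[OF line[of "snd c p" "axis i 1"], of "\<lambda>_. snd d q" 0, OF _ g G]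
    unfolding D1 D3 D4 A_eq[symmetric] by (simp add: coordinate_line_def)
  show "((\<lambda>t. L p (coordinate_line d i q t) (g t) (G t)) has_real_derivative
       D2 d L p q (g 0) (G 0) $ i + D3 L p q (g 0) (G 0) * g' + D4 L p q (g 0) (G 0) * G') (at 0)"
    using curve[OF _ line[of "snd d q" "axis i 1"], of "\<lambda>_. snd c p" 0, OF _ g G]
    unfolding D2 D3 D4 A_eq[symmetric] by (simp add: coordinate_line_def)
qed

end

section \<open>Implicit differentiation of the relation determining \<zeta>\<close>

text \<open>The existence half: the equivalence is instantiated at the value of \<zeta>, which lies
  in the neighbourhood \<open>R\<close>.\<close>

lemma determines_nearE:
  assumes "determines_near Q \<A> L h p q s r \<zeta>"
  obtains U V S where "openin Q U" "openin Q V" "open S" "p \<in> U" "q \<in> V" "s \<in> S"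
    "smooth_QQ_on \<A> U V S \<zeta>"
    "\<forall>p'\<in>U. \<forall>q'\<in>V. \<forall>s'\<in>S. \<zeta> p' q' s' - s' = h * L p' q' s' (\<zeta> p' q' s')"
  using assms unfolding determines_near_def by (elim exE conjE) (rule that, assumption+, simp)

text \<open>The uniqueness half: \<open>r\<close> lies in \<open>R\<close> and solves the relation
  at the base point.\<close>

lemma determines_near_eq:
  assumes "determines_near Q \<A> L h p q s r \<zeta>" and "r - s = h * L p q s r"
  shows "\<zeta> p q s = r"
  using assms unfolding determines_near_def by metis

text \<open>Both sides of the relation agree along the line near 0, so their derivatives agree. The
  function \<open>g\<close> stands for z at index j as the point at index j moves; the result is
  left undivided, so no nonvanishing is assumed.\<close>

lemma determines_near_fst_line_derivative:
  assumes mf: "smooth_manifold Q \<A>" and dL: "discrete_Lagrangian Q \<A> L"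
    and det: "determines_near Q \<A> L h p q s r \<zeta>" and eq: "r - s = h * L p q s r"
    and c: "c \<in> \<A>" "p \<in> fst c" and d: "d \<in> \<A>" "q \<in> fst d"
    and g: "(g has_real_derivative g') (at 0)" and g0: "g 0 = s"
  obtains G' where
    "((\<lambda>t. \<zeta> (coordinate_line c i p t) q (g t)) has_real_derivative G') (at 0)"
    and "(1 - h * D4 L p q s r) * G' = h * D1 c L p q s r $ i + (1 + h * D3 L p q s r) * g'"
proof -
  obtain U V S where *: "openin Q U" "openin Q V" "open S" "p \<in> U" "q \<in> V" "s \<in> S"
    and smooth: "smooth_QQ_on \<A> U V S \<zeta>"
    and sol: "\<forall>p'\<in>U. \<forall>q'\<in>V. \<forall>s'\<in>S.
           \<zeta> p' q' s' - s' = h * L p' q' s' (\<zeta> p' q' s')"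
    using determines_nearE[OF det] .
  let ?p = "coordinate_line c i p"
  let ?G = "\<lambda>t. \<zeta> (?p t) q (g t)"
  obtain G' where G: "(?G has_real_derivative G') (at 0)"
    using smooth_QQ_on_fst_line_differentiable[OF mf smooth, of c d p q g g' i] c d * g g0
    by (auto simp: has_real_derivative_iff_has_vector_derivative)
  have G0: "?G 0 = r"
    using determines_near_eq[OF det eq] g0 coordinate_line_0[OF mf c] by simp
  \<comment> \<open>Continuity of \<open>g\<close> keeps the real argument in \<open>S\<close> for
    small \<open>t\<close>.\<close>
  have "isCont g 0" using g by (rule DERIV_isCont)
  then have "(g \<longlongrightarrow> g 0) (nhds 0)"
    by (simp add: isCont_def tendsto_at_iff_tendsto_nhds)
  then have "\<forall>\<^sub>F t in nhds 0. g t \<in> S"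
    by (rule topological_tendstoD) (use \<open>open S\<close> \<open>s \<in> S\<close> g0 in auto)
  moreover have "\<forall>\<^sub>F t in nhds 0. ?p t \<in> U"
    using eventually_coordinate_line_in[OF mf c(1) *(1) c(2) *(4)] .
  ultimately have "\<forall>\<^sub>F t in nhds 0. ?G t - g t = h * L (?p t) q (g t) (?G t)"
    by eventually_elim (use sol \<open>q \<in> V\<close> in blast)
  moreover have "((\<lambda>t. ?G t - g t) has_real_derivative G' - g') (at 0)"
    using G g by (rule DERIV_diff)
  \<comment> \<open>The local equality transfers the derivative to the right-hand side, whose
    derivative is then computed a second time by the chain rule and compared.\<close>
  ultimately have "((\<lambda>t. h * L (?p t) q (g t) (?G t)) has_real_derivative G' - g') (at 0)"
    by (subst (asm) DERIV_cong_ev[OF refl _ refl])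
  moreover have "((\<lambda>t. h * L (?p t) q (g t) (?G t)) has_real_derivative
      h * (D1 c L p q s r $ i + D3 L p q s r * g' + D4 L p q s r * G')) (at 0)"
    using discrete_Lagrangian_fst_line_derivative[OF mf dL c d g G, of i] G0 g0
    by (intro DERIV_cmult) simp
  ultimately have "G' - g' = h * (D1 c L p q s r $ i + D3 L p q s r * g' + D4 L p q s r * G')"
    by (rule DERIV_unique)
  then have "(1 - h * D4 L p q s r) * G' = h * D1 c L p q s r $ i + (1 + h * D3 L p q s r) * g'"
    by (simp add: algebra_simps)
  with G show thesis by (rule that)
qed

text \<open>The same argument with the real argument frozen at \<open>s\<close>, since earlier
  values of z ignore a change of the later point.\<close>

lemma determines_near_snd_line_derivative:
  assumes mf: "smooth_manifold Q \<A>" and dL: "discrete_Lagrangian Q \<A> L"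
    and det: "determines_near Q \<A> L h p q s r \<zeta>" and eq: "r - s = h * L p q s r"
    and c: "c \<in> \<A>" "p \<in> fst c" and d: "d \<in> \<A>" "q \<in> fst d"
  obtains G' where
    "((\<lambda>t. \<zeta> p (coordinate_line d i q t) s) has_real_derivative G') (at 0)"
    and "(1 - h * D4 L p q s r) * G' = h * D2 d L p q s r $ i"
proof -
  obtain U V S where *: "openin Q U" "openin Q V" "open S" "p \<in> U" "q \<in> V" "s \<in> S"
    and smooth: "smooth_QQ_on \<A> U V S \<zeta>"
    and sol: "\<forall>p'\<in>U. \<forall>q'\<in>V. \<forall>s'\<in>S.
           \<zeta> p' q' s' - s' = h * L p' q' s' (\<zeta> p' q' s')"
    using determines_nearE[OF det] .
  let ?q = "coordinate_line d i q"
  let ?G = "\<lambda>t. \<zeta> p (?q t) s"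
  obtain G' where G: "(?G has_real_derivative G') (at 0)"
    using smooth_QQ_on_snd_line_differentiable[OF mf smooth, of c d p q s i] c d * by auto
  have G0: "?G 0 = r"
    using determines_near_eq[OF det eq] coordinate_line_0[OF mf d] by simp
  have "\<forall>\<^sub>F t in nhds 0. ?q t \<in> V"
    using eventually_coordinate_line_in[OF mf d(1) *(2) d(2) *(5)] .
  then have "\<forall>\<^sub>F t in nhds 0. ?G t - s = h * L p (?q t) s (?G t)"
    by eventually_elim (use sol \<open>p \<in> U\<close> \<open>s \<in> S\<close> in blast)
  moreover have "((\<lambda>t. ?G t - s) has_real_derivative G') (at 0)"
    using DERIV_diff[OF G DERIV_const, of s] by simp
  ultimately have "((\<lambda>t. h * L p (?q t) s (?G t)) has_real_derivative G') (at 0)"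
    by (subst (asm) DERIV_cong_ev[OF refl _ refl])
  moreover have "((\<lambda>t. h * L p (?q t) s (?G t)) has_real_derivative
      h * (D2 d L p q s r $ i + D4 L p q s r * G')) (at 0)"
    \<comment> \<open>The constant curve at \<open>s\<close> has slope 0, which removes the
      \<open>D3\<close> term.\<close>
    using discrete_Lagrangian_snd_line_derivative[OF mf dL c d DERIV_const[of s] G, of i] G0
    by (intro DERIV_cmult) simp
  ultimately have "G' = h * (D2 d L p q s r $ i + D4 L p q s r * G')"
    by (rule DERIV_unique)
  then have "(1 - h * D4 L p q s r) * G' = h * D2 d L p q s r $ i"
    by (simp add: algebra_simps)
  with G show thesis by (rule that)
qed

section \<open>The recursion for z and the Euler-Lagrange equations\<close>

lemma z_of_fun_upd_later: "k < j \<Longrightarrow> z_of \<zeta> (x(j := p)) k = z_of \<zeta> x k"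
  by (induction k) auto

theorem theorem1:
  fixes Q :: "'q topology"
    and \<A> :: "('q, 'n::finite) chart set"
    and L :: "'q \<Rightarrow> 'q \<Rightarrow> real \<Rightarrow> real \<Rightarrow> real"
    and h :: real
    and N :: nat
    and x :: "nat \<Rightarrow> 'q"
    and z :: "nat \<Rightarrow> real"
    and c :: "nat \<Rightarrow> ('q, 'n) chart"
    and \<zeta> :: "nat \<Rightarrow> 'q \<Rightarrow> 'q \<Rightarrow> real \<Rightarrow> real"
  assumes "smooth_manifold Q \<A>"
    and "discrete_Lagrangian Q \<A> L"
    and "h > 0"
    and "\<And>j. j \<le> N \<Longrightarrow> x j \<in> topspace Q"
    and "\<And>j. j \<le> N \<Longrightarrow> c j \<in> \<A> \<and> x j \<in> fst (c j)"
    and "z 0 = 0"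
    and "\<And>j. j < N \<Longrightarrow> z (j + 1) - z j = h * L (x j) (x (j + 1)) (z j) (z (j + 1))"
    and "\<And>j. j < N \<Longrightarrow>
           determines_near Q \<A> L h (x j) (x (j + 1)) (z j) (z (j + 1)) (\<zeta> j)"
    and "\<And>j. j < N \<Longrightarrow> 1 - h * D4 L (x j) (x (j + 1)) (z j) (z (j + 1)) \<noteq> 0"
  shows "discrete_Herglotz_solution c \<zeta> N x \<longleftrightarrow>
    (\<forall>j\<in>{1..<N}.
       D1 (c j) L (x j) (x (j + 1)) (z j) (z (j + 1))
       + ((1 + h * D3 L (x j) (x (j + 1)) (z j) (z (j + 1)))
            / (1 - h * D4 L (x (j - 1)) (x j) (z (j - 1)) (z j)))
         *\<^sub>R D2 (c j) L (x (j - 1)) (x j) (z (j - 1)) (z j) = 0)"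
proof -
  note mf = assms(1) and dL = assms(2)
  have chart: "c j \<in> \<A>" "x j \<in> fst (c j)" if "j \<le> N" for j
    using assms(5) that by auto
  \<comment> \<open>Local uniqueness at the base points identifies the values generated by \<zeta>
    with the given \<open>z\<close>.\<close>
  have z_eq: "z_of \<zeta> x j = z j" if "j \<le> N" for j
    using that
  proof (induction j)
    case 0
    then show ?case using \<open>z 0 = 0\<close> by simp
  next
    case (Suc j)
    then have "j < N" by simp
    with Suc determines_near_eq[OF assms(8) assms(7)] show ?case by simp
  qed
  have "chart_partials (c j) (\<lambda>p. z_of \<zeta> (x(j := p)) (j + 1)) (x j) $ i = 0 \<longleftrightarrow>
      (D1 (c j) L (x j) (x (j + 1)) (z j) (z (j + 1))
       + ((1 + h * D3 L (x j) (x (j + 1)) (z j) (z (j + 1)))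
            / (1 - h * D4 L (x (j - 1)) (x j) (z (j - 1)) (z j)))
         *\<^sub>R D2 (c j) L (x (j - 1)) (x j) (z (j - 1)) (z j)) $ i = 0"
    if "j \<in> {1..<N}" for j i
  proof -
    \<comment> \<open>Here \<open>k\<close> is \<open>j - 1\<close>, a genuine predecessor because
      \<open>j\<close> is at least 1.\<close>
    obtain k where j: "j = Suc k" using \<open>j \<in> {1..<N}\<close> by (cases j) auto
    then have N: "k < N" "j < N" "k \<le> N" "j \<le> N" "j + 1 \<le> N" using \<open>j \<in> {1..<N}\<close> by auto
    let ?p = "coordinate_line (c j) i (x j)"
    define g where "g t = \<zeta> k (x k) (?p t) (z k)" for t
    let ?a = "1 - h * D4 L (x k) (x j) (z k) (z j)"
    let ?b = "1 - h * D4 L (x j) (x (j + 1)) (z j) (z (j + 1))"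
    let ?d1 = "D1 (c j) L (x j) (x (j + 1)) (z j) (z (j + 1)) $ i"
    let ?d2 = "D2 (c j) L (x k) (x j) (z k) (z j) $ i"
    let ?e = "1 + h * D3 L (x j) (x (j + 1)) (z j) (z (j + 1))"
    have det: "determines_near Q \<A> L h (x k) (x j) (z k) (z j) (\<zeta> k)"
      and eq: "z j - z k = h * L (x k) (x j) (z k) (z j)"
      using assms(7,8)[OF N(1)] j by auto
    obtain g' where g: "(g has_real_derivative g') (at 0)" and g': "?a * g' = h * ?d2"
      unfolding g_def
      using determines_near_snd_line_derivative[OF mf dL det eq chart[OF N(3)] chart[OF N(4)]] .
    have g0: "g 0 = z j"
      unfolding g_def using determines_near_eq[OF det eq] coordinate_line_0[OF mf chart[OF N(4)]]
      by simp
    obtain G' where G: "((\<lambda>t. \<zeta> j (?p t) (x (j + 1)) (g t)) has_real_derivative G') (at 0)"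
      and G': "?b * G' = h * ?d1 + ?e * g'"
      using determines_near_fst_line_derivative[OF mf dL assms(8)[OF N(2)] assms(7)[OF N(2)]
          chart[OF N(4)] chart[OF N(5)] g g0] .
    \<comment> \<open>The moving point enters twice: directly through the first slot of
      \<open>\<zeta> j\<close>, and through z at index j, which \<open>g\<close> tracks along the
      coordinate line.\<close>
    have "z_of \<zeta> (x(j := p)) (j + 1) = \<zeta> j p (x (j + 1)) (\<zeta> k (x k) p (z k))" for p
      using z_eq[OF N(3)] z_of_fun_upd_later[of k j \<zeta> x p] j by simp
    then have "chart_partials (c j) (\<lambda>p. z_of \<zeta> (x(j := p)) (j + 1)) (x j) $ i = G'"
      using G unfolding chart_partials_nth g_def by (simp add: DERIV_imp_deriv)
    moreover have "?a \<noteq> 0" "?b \<noteq> 0" using assms(9)[OF N(1)] assms(9)[OF N(2)] j by simp_all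
    then have "g' = h * ?d2 / ?a" using g' by (simp add: field_simps)
    then have "?b * G' = h * (?d1 + ?e / ?a * ?d2)"
      using G' by (simp add: algebra_simps)
    \<comment> \<open>The factors \<open>?b\<close> and \<open>h\<close> are nonzero, so either side
      of the preceding equation vanishes exactly when its other factor does.\<close>
    then have "G' = 0 \<longleftrightarrow> ?d1 + ?e / ?a * ?d2 = 0"
      using \<open>?b \<noteq> 0\<close> \<open>h > 0\<close> by (metis less_irrefl mult_eq_0_iff)
    ultimately show ?thesis using j by simp
  qed
  then show ?thesis
    unfolding discrete_Herglotz_solution_def vec_eq_iff by (simp only: zero_index cong: ball_cong)
qed

end
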